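(* Let $\omega_1\in\mathbb{C}\setminus\{0\}$, let $\Lambda=\mathbb{Z}\omega_1+\mathbb{Z}\,i\omega_1$ be a square lattice, let $\wp(z)=\wp(z;\Lambda)$, and let $G$ be the wallpaper group p4 realised as the group generated by the translations $z\mapsto z+\omega$ ($\omega\in\Lambda$) and the rotation $z\mapsto iz$. Then the meromorphic functions $f:\mathbb{C}\to\mathbb{CP}^1$ that are $G$-invariant are exactly the functions of the form $f(z)=T(\wp(z)^2)$ with $T$ a rational function with complex coefficients.
   Context: $f$ is $G$-invariant if $f(g.z)=f(z)$ for all $g\in G$ and $z\in\mathbb{C}$. The Weierstrass function of a lattice $\Lambda$ is $\wp(z;\Lambda)=\frac1{z^2}+\sum_{\omega\in\Lambda\setminus\{0\}}\left(\frac1{(z-\omega)^2}-\frac1{\omega^2}\right)$. *)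

theory Defs
  imports
    "HOL-Complex_Analysis.Complex_Analysis"
    "HOL-Computational_Algebra.Computational_Algebra"
    "HOL-Computational_Algebra.Field_as_Ring"
    "HOL-Algebra.Generated_Groups"
    "HOL-Algebra.Bij"
begin

text \<open>The projective line as the Riemann sphere; \<open>None\<close> is the point at infinity.\<close>

type_synonym cp1 = "complex option"

definition finite_part :: "(complex \<Rightarrow> cp1) \<Rightarrow> complex \<Rightarrow> complex" where
  "finite_part f z = (case f z of Some w \<Rightarrow> w | None \<Rightarrow> 0)"

text \<open>
  In a nicely meromorphic function all removable singularities are removed and poles carry
  the placeholder value 0. A function into the projective line is meromorphic iff it takes the
  value \<open>None\<close> exactly at the poles of such a function and agrees with it elsewhere. As usual,
  the constant function with value infinity is not meromorphic.
\<close>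

definition meromorphic_cp1 :: "(complex \<Rightarrow> cp1) \<Rightarrow> bool" where
  "meromorphic_cp1 f \<longleftrightarrow>
     finite_part f nicely_meromorphic_on UNIV \<and>
     (\<forall>z. f z = None \<longleftrightarrow> is_pole (finite_part f) z)"

definition lattice_of :: "complex \<Rightarrow> complex \<Rightarrow> complex set" where
  "lattice_of a b = {of_int m * a + of_int n * b | m n :: int. True}"

definition weierstrass_p :: "complex set \<Rightarrow> complex \<Rightarrow> cp1" where
  "weierstrass_p \<Lambda> z =
     (if z \<in> \<Lambda> then None
      else Some (1 / z ^ 2 + (\<Sum>\<^sub>\<infinity>\<omega>\<in>\<Lambda> - {0}. (1 / (z - \<omega>) ^ 2 - 1 / \<omega> ^ 2))))"

definition cp1_square :: "cp1 \<Rightarrow> cp1" where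
  "cp1_square = map_option (\<lambda>w. w ^ 2)"

text \<open>
  The self-map of the projective line given by a rational function. The pair
  \<open>quot_of_fract T\<close> is in lowest terms, so numerator and denominator never vanish together;
  the value at infinity is the limit of \<open>p(w) / q(w)\<close> as \<open>w\<close> tends to infinity.
\<close>

definition rat_fun :: "complex poly fract \<Rightarrow> cp1 \<Rightarrow> cp1" where
  "rat_fun T x =
     (let (p, q) = quot_of_fract T in
      case x of
        Some w \<Rightarrow> if poly q w = 0 then None else Some (poly p w / poly q w)
      | None \<Rightarrow> if degree p > degree q then None
                else Some (coeff p (degree q) / lead_coeff q))"

definition p4_group :: "complex set \<Rightarrow> (complex \<Rightarrow> complex) set" where
  "p4_group \<Lambda> =
     generate (BijGroup UNIV) ({(\<lambda>z. z + \<omega>) | \<omega>. \<omega> \<in> \<Lambda>} \<union> {(\<lambda>z. \<i> * z)})"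

definition invariant_under :: "(complex \<Rightarrow> complex) set \<Rightarrow> (complex \<Rightarrow> cp1) \<Rightarrow> bool" where
  "invariant_under G f \<longleftrightarrow> (\<forall>g\<in>G. \<forall>z. f (g z) = f z)"

end

theory Submission
  imports Defs
begin

text \<open>
  Put \<open>U = \<wp>\<^sup>2\<close>. It is invariant because \<open>\<wp>(i z) = - \<wp>(z)\<close>, it has poles exactly at the
  lattice points, and \<open>z\<^sup>4 U(z)\<close> tends to 1 at the origin. Given an invariant meromorphic \<open>f\<close>,
  only finitely many poles lie in a fundamental square and off the lattice, and multiplying by
  suitable powers of \<open>U - U(a)\<close> removes them. The result \<open>g\<close> has poles in the lattice only; since
  \<open>g(i z) = g(z)\<close>, its pole order at the origin is a multiple of 4, so subtracting a multiple of
  a power of \<open>U\<close> lowers it. When no pole is left, Liouville's theorem shows that a constant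
  remains. Hence \<open>g\<close> is a polynomial in \<open>U\<close>. The valence of \<open>\<wp>\<close> is never needed.
\<close>

section \<open>Analytic preliminaries\<close>

lemma summable_on_int_powr:
  "(\<lambda>m::int. (1 + \<bar>of_int m\<bar>) powr (-3/2) :: real) summable_on UNIV" (is "?a summable_on _")
proof -
  have "summable (\<lambda>n. real n powr (-3/2))"
    by (simp add: summable_real_powr_iff)
  then have sums: "summable (\<lambda>n. (1 + real n) powr (-3/2))"
    by (subst (asm) summable_Suc_iff[symmetric]) (simp add: add.commute)
  then have nat: "(\<lambda>n. (1 + real n) powr (-3/2)) summable_on UNIV"
    by (subst summable_on_UNIV_nonneg_real_iff) auto
  \<comment> \<open>The integers are split into \<open>range int\<close> and the numbers
    \<open>- int (Suc n)\<close>, so that 0 is counted only once.\<close>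
  have nonneg: "?a summable_on range int"
    by (subst summable_on_reindex) (use nat in \<open>auto simp: o_def inj_def\<close>)
  have "(\<lambda>n. (1 + real (Suc n)) powr (-3/2)) summable_on UNIV"
    using sums by (subst (asm) summable_Suc_iff[symmetric], subst summable_on_UNIV_nonneg_real_iff) auto
  then have neg: "?a summable_on range (\<lambda>n. - int (Suc n))"
    by (subst summable_on_reindex) (auto simp: o_def inj_def)
  have "m \<in> range int \<union> range (\<lambda>n. - int (Suc n))" for m
    by (cases m rule: int_cases) auto
  then have "range int \<union> range (\<lambda>n. - int (Suc n)) = UNIV"
    by blast
  moreover have "range int \<inter> range (\<lambda>n. - int (Suc n)) = {}"
    by (auto simp: image_iff)
  ultimately show ?thesis
    using summable_on_Un_disjoint[OF nonneg neg] by simp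
qed

text \<open>A product of two one-dimensional series dominates the double series. Away from the
  origin \<open>(1 + |m|) * (1 + |n|) \<le> 4 * (m^2 + n^2)\<close>; the power 3/2 turns the right
  side into 8 times the cube of the modulus and leaves the convergent exponent 3/2 in each
  variable.\<close>

lemma summable_on_gauss_int_cube:
  "(\<lambda>(m, n). 1 / cmod (of_int m + \<i> * of_int n) ^ 3) summable_on UNIV \<times> (UNIV :: int set)"
proof -
  define a where "a = (\<lambda>m::int. (1 + \<bar>of_int m\<bar>) powr (-3/2) :: real)"
  have a: "a summable_on UNIV"
    unfolding a_def by (rule summable_on_int_powr)
  have "(\<lambda>(m, n). a m * a n) summable_on UNIV \<times> UNIV"
  proof (rule summable_on_SigmaI)
    show "((\<lambda>n. case (m, n) of (m, n) \<Rightarrow> a m * a n) has_sum a m * infsum a UNIV) UNIV" for m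
      using a by (auto intro!: has_sum_cmult_right has_sum_infsum)
    show "(\<lambda>m. a m * infsum a UNIV) summable_on UNIV"
      using a by (rule summable_on_cmult_left)
  qed (auto simp: a_def)
  then have "(\<lambda>x. 8 * (case x of (m, n) \<Rightarrow> a m * a n)) summable_on UNIV \<times> UNIV"
    by (rule summable_on_cmult_right)
  then show ?thesis
  proof (rule summable_on_comparison_test)
    fix x :: "int \<times> int"
    obtain m n where x: "x = (m, n)"
      by force
    define s :: real where "s = (of_int m)\<^sup>2 + (of_int n)\<^sup>2"
    have norm: "cmod (of_int m + \<i> * of_int n) = s powr (1/2)"
      by (simp add: s_def cmod_def powr_half_sqrt)
    show "(case x of (m, n) \<Rightarrow> 1 / cmod (of_int m + \<i> * of_int n) ^ 3) \<le> 8 * (case x of (m, n) \<Rightarrow> a m * a n)"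
    \<comment> \<open>At the origin the left side is \<open>1 / 0\<close>, which is 0 by
      convention.\<close>
    proof (cases "s = 0")
      case True
      then show ?thesis
        by (simp add: x norm a_def)
    next
      case False
      have "m\<^sup>2 + n\<^sup>2 \<noteq> 0"
        using False unfolding s_def by (metis of_int_0 of_int_add of_int_power)
      then have "m\<^sup>2 + n\<^sup>2 \<ge> 1"
        by (smt (verit) zero_le_power2)
      then have s1: "s \<ge> 1"
        unfolding s_def by (metis of_int_1 of_int_add of_int_le_iff of_int_power)
      have sq: "\<bar>of_int k\<bar> \<le> (of_int k :: real)\<^sup>2" for k :: int
      proof -
        have "\<bar>k\<bar> * 1 \<le> \<bar>k\<bar> * \<bar>k\<bar>"
          by (cases "k = 0") (simp, intro mult_left_mono, auto)
        then have "\<bar>k\<bar> \<le> k\<^sup>2"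
          by (simp add: power2_eq_square)
        then show ?thesis
          by (metis of_int_abs of_int_le_iff of_int_power)
      qed
      have "0 \<le> (\<bar>of_int m\<bar> - \<bar>of_int n\<bar> :: real)\<^sup>2"
        by simp
      then have "2 * (\<bar>of_int m\<bar> * \<bar>of_int n\<bar>) \<le> s"
        by (simp add: s_def power2_diff)
      then have "(1 + \<bar>of_int m\<bar>) * (1 + \<bar>of_int n\<bar>) \<le> 4 * s"
        using sq[of m] sq[of n] s1 by (simp add: algebra_simps s_def)
      then have "((1 + \<bar>of_int m\<bar>) * (1 + \<bar>of_int n\<bar>)) powr (3/2) \<le> (4 * s) powr (3/2)"
        by (intro powr_mono2) auto
      also have "(4::real) powr (3/2) = 8"
      proof -
        have "(4::real) powr (3/2) = (2 powr 2) powr (3/2)"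
          by simp
        also have "\<dots> = 2 powr 3"
          by (simp only: powr_powr) simp
        finally show ?thesis by simp
      qed
      then have "(4 * s) powr (3/2) = 8 * s powr (3/2)"
        using s1 by (simp add: powr_mult)
      finally have le: "((1 + \<bar>of_int m\<bar>) * (1 + \<bar>of_int n\<bar>)) powr (3/2) \<le> 8 * s powr (3/2)" .
      have pos: "((1 + \<bar>of_int m\<bar>) * (1 + \<bar>of_int n\<bar>)) powr (3/2) > (0::real)"
        by (smt (verit) mult_pos_pos powr_gt_zero)
      have "1 / s powr (3/2) \<le> 8 / ((1 + \<bar>of_int m\<bar>) * (1 + \<bar>of_int n\<bar>)) powr (3/2)"
        using le pos s1 by (simp add: field_simps)
      also have "\<dots> = 8 * (a m * a n)"
        by (simp add: a_def powr_mult powr_minus_divide)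
      also have "s powr (3/2) = (s powr (1/2)) ^ 3"
        using s1 by (simp add: powr_power)
      finally show ?thesis
        by (simp add: x norm)
    qed
  qed (auto simp: case_prod_unfold)
qed

lemma has_sum_minus:
  fixes f :: "_ \<Rightarrow> 'a::topological_ab_group_add"
  assumes "(f has_sum a) A" "(g has_sum b) A"
  shows "((\<lambda>x. f x - g x) has_sum a - b) A"
  using has_sum_add[OF assms(1), of "\<lambda>x. - g x" "- b"] assms(2) by (simp add: has_sum_uminus)

section \<open>Local behaviour of meromorphic functions\<close>

lemma meromorphic_pole_order_bound:
  assumes "f meromorphic_on {z}"
  obtains n l where "((\<lambda>x. (x - z) ^ n * f x) \<longlongrightarrow> l) (at z)"
\<comment> \<open>A function vanishing near \<open>z\<close> has no meaningful
  \<open>zorder\<close>, hence the separate case.\<close>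
proof (cases "eventually (\<lambda>x. f x = 0) (at z)")
  case True
  then have "eventually (\<lambda>x. (x - z) ^ 0 * f x = 0) (at z)"
    by eventually_elim auto
  then show ?thesis
    using that[of 0 0] by (simp add: tendsto_eventually)
next
  case False
  define n where "n = zorder f z"
  define g where "g = zor_poly f z"
  obtain r where r: "r > 0" "g holomorphic_on cball z r"
    "\<forall>x\<in>cball z r - {z}. f x = g x * (x - z) powi n \<and> g x \<noteq> 0"
    using zorder_exist[of f z] assms False unfolding n_def g_def meromorphic_at_iff frequently_def
    by auto
  \<comment> \<open>\<open>N\<close> is the pole order and \<open>M\<close> the order of vanishing;
    truncation by \<open>nat\<close> makes at most one of them nonzero, so one limit covers both
    signs of \<open>n\<close>.\<close>
  define N where "N = nat (- n)"
  define M where "M = nat n"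
  have "isCont g z"
    using r(1,2) by (metis centre_in_ball continuous_on_interior holomorphic_on_imp_continuous_on interior_cball)
  then have "((\<lambda>x. (x - z) ^ M * g x) \<longlongrightarrow> (z - z) ^ M * g z) (at z)"
    by (intro tendsto_intros) (auto simp: isCont_def)
  moreover have "eventually (\<lambda>x. x \<in> ball z r - {z}) (at z)"
    using r(1) by (intro eventually_at_in_open) auto
  then have "eventually (\<lambda>x. (x - z) ^ N * f x = (x - z) ^ M * g x) (at z)"
  proof eventually_elim
    case (elim x)
    have "(x - z) ^ N * (x - z) powi n = (x - z) ^ M"
      using elim by (cases "n \<ge> 0") (auto simp: N_def M_def power_int_def simp flip: power_mult_distrib)
    then show ?case
      using elim r(3) by (simp add: mult_ac)
  qed
  ultimately show ?thesis
    using that[of N] by (simp add: tendsto_cong)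
qed

text \<open>Extended by 0 at \<open>z\<close>, the product \<open>(x - z) ^ Suc n * f x\<close>
  becomes analytic there, and its difference quotient at \<open>z\<close> is
  \<open>(x - z) ^ n * f x\<close>. In \<open>polynomial_in_U\<close> this lowers the bound on the
  pole order by one.\<close>

lemma meromorphic_vanishing_limit_divide:
  assumes "f meromorphic_on {z}" "((\<lambda>x. (x - z) ^ Suc n * f x) \<longlongrightarrow> 0) (at z)"
  obtains l where "((\<lambda>x. (x - z) ^ n * f x) \<longlongrightarrow> l) (at z)"
proof -
  define k where "k = (\<lambda>x. if x = z then 0 else (x - z) ^ Suc n * f x)"
  have "(\<lambda>x. (x - z) ^ Suc n * f x) meromorphic_on {z}"
    using assms(1) by (intro meromorphic_intros)
  then have "k analytic_on {z}"
    unfolding k_def using assms(2) by (intro removable_singularity') (auto simp: meromorphic_at_iff)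
  then obtain D where "(k has_field_derivative D) (at z)"
    using analytic_on_imp_differentiable_at field_differentiable_def by blast
  then have "((\<lambda>x. (k x - k z) / (x - z)) \<longlongrightarrow> D) (at z)"
    by (simp add: has_field_derivative_iff)
  moreover have "eventually (\<lambda>x. (k x - k z) / (x - z) = (x - z) ^ n * f x) (at z)"
    using eventually_neq_at_within[of z z UNIV] by eventually_elim (simp add: k_def)
  ultimately show ?thesis
    using that by (simp add: tendsto_cong)
qed

lemma meromorphic_on_poly_compose:
  "g meromorphic_on A \<Longrightarrow> (\<lambda>z. poly p (g z)) meromorphic_on A"
  unfolding poly_altdef by (intro meromorphic_intros)

text \<open>The multiplicative order of \<open>\<i>\<close> is 4. This later forces a nonzero
  leading coefficient at the origin to belong to a pole order divisible by 4.\<close>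

lemma ii_power_eq_1_imp_dvd:
  assumes "\<i> ^ n = 1"
  shows "4 dvd n"
proof -
  have "\<i> ^ n = \<i> ^ (n mod 4)"
  proof -
    have "\<i> ^ n = (\<i> ^ 4) ^ (n div 4) * \<i> ^ (n mod 4)"
      by (metis mult_div_mod_eq power_add power_mult)
    then show ?thesis
      by simp
  qed
  moreover have "n mod 4 = 0 \<or> n mod 4 = 1 \<or> n mod 4 = 2 \<or> n mod 4 = 3"
    by presburger
  ultimately show ?thesis
    using assms by (auto simp: power3_eq_cube complex_eq_iff mod_eq_0_iff_dvd)
qed

lemma filterlim_at_0_cmult:
  fixes c :: complex
  assumes "filterlim f F (at 0)" "c \<noteq> 0"
  shows "filterlim (\<lambda>z. f (c * z)) F (at 0)"
proof (rule filterlim_compose[OF assms(1)])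
  show "filterlim ((*) c) (at 0) (at 0)"
    using assms(2) by (auto intro!: filterlim_atI tendsto_eq_intros eventually_mono[OF eventually_neq_at_within])
qed

section \<open>Rational functions at infinity\<close>

lemma poly_over_power_tendsto:
  fixes p :: "'a::real_normed_field poly"
  assumes "degree p \<le> n"
  shows "((\<lambda>x. poly p x / x ^ n) \<longlongrightarrow> coeff p n) at_infinity"
proof (cases "degree p = n")
  case True
  then show ?thesis
    using poly_divide_tendsto_aux[of p] by simp
next
  case False
  then have "((\<lambda>x. poly p x / poly (monom 1 n) x) \<longlongrightarrow> 0) at_infinity"
    using assms by (intro poly_divide_tendsto_0_at_infinity) (simp add: degree_monom_eq)
  then show ?thesis
    using False assms by (simp add: poly_monom coeff_eq_0)
qed

text \<open>Dividing both polynomials by \<open>x ^ degree q\<close> leaves quotients with finite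
  limits. If \<open>p\<close> has smaller degree, its coefficient at \<open>degree q\<close> is 0,
  so one formula serves both cases; it is the value of \<open>rat_fun\<close> at
  \<open>None\<close>.\<close>

lemma rational_tendsto_at_infinity:
  fixes p q :: "'a::real_normed_field poly"
  assumes "degree p \<le> degree q" "q \<noteq> 0"
  shows "((\<lambda>x. poly p x / poly q x) \<longlongrightarrow> coeff p (degree q) / lead_coeff q) at_infinity"
proof -
  have "((\<lambda>x. (poly p x / x ^ degree q) / (poly q x / x ^ degree q)) \<longlongrightarrow>
      coeff p (degree q) / lead_coeff q) at_infinity"
    using assms by (intro tendsto_intros poly_over_power_tendsto) auto
  moreover have "eventually (\<lambda>x. (poly p x / x ^ degree q) / (poly q x / x ^ degree q) = poly p x / poly q x) at_infinity"
    by (rule eventually_at_infinityI[of 1]) auto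
  ultimately show ?thesis
    by (rule Lim_transform_eventually)
qed

lemma rational_filterlim_at_infinity:
  fixes p q :: "'a::real_normed_field poly"
  assumes "degree q < degree p" "q \<noteq> 0"
  shows "filterlim (\<lambda>x. poly p x / poly q x) at_infinity at_infinity"
proof -
  have "((\<lambda>x. (poly p x / x ^ degree p) / (poly q x / x ^ degree q)) \<longlongrightarrow> lead_coeff p / lead_coeff q) at_infinity"
    using assms by (intro tendsto_intros poly_over_power_tendsto) auto
  moreover have "p \<noteq> 0"
    using assms by auto
  moreover have "filterlim (\<lambda>x::'a. x ^ (degree p - degree q)) at_infinity at_infinity"
    using assms by (intro filterlim_power_at_infinity filterlim_ident) auto
  ultimately have "filterlim (\<lambda>x. (poly p x / x ^ degree p) / (poly q x / x ^ degree q) * x ^ (degree p - degree q)) at_infinity at_infinity"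
    using assms by (intro tendsto_mult_filterlim_at_infinity) auto
  moreover have "eventually (\<lambda>x. (poly p x / x ^ degree p) / (poly q x / x ^ degree q) * x ^ (degree p - degree q) =
      poly p x / poly q x) at_infinity"
  proof (rule eventually_at_infinityI[of 1])
    fix x :: 'a assume "1 \<le> norm x"
    then have "x \<noteq> 0"
      by auto
    moreover have "x ^ degree p = x ^ degree q * x ^ (degree p - degree q)"
      using assms by (simp flip: power_add)
    ultimately show "(poly p x / x ^ degree p) / (poly q x / x ^ degree q) * x ^ (degree p - degree q) = poly p x / poly q x"
      by simp
  qed
  ultimately show ?thesis
    by (simp add: filterlim_cong)
qed

section \<open>Meromorphic maps into the projective line\<close>

lemma meromorphic_cp1I:
  assumes "g meromorphic_on UNIV"
    and "\<And>z. eventually (\<lambda>x. finite_part f x = g x) (at z)"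
    and "\<And>z. f z = None \<Longrightarrow> is_pole g z"
    and "\<And>z v. f z = Some v \<Longrightarrow> (g \<longlongrightarrow> v) (at z)"
  shows "meromorphic_cp1 f"
proof -
  have pole: "is_pole (finite_part f) z \<longleftrightarrow> is_pole g z" for z
    using assms(2) by (intro is_pole_cong) auto
  have lim: "(finite_part f \<longlongrightarrow> v) (at z) \<longleftrightarrow> (g \<longlongrightarrow> v) (at z)" for v z
    using assms(2) by (intro tendsto_cong)
  have "finite_part f meromorphic_on UNIV"
    using assms(1,2) meromorphic_on_cong[of UNIV "finite_part f" g] by blast
  moreover have "(is_pole (finite_part f) z \<and> finite_part f z = 0) \<or> (finite_part f \<longlongrightarrow> finite_part f z) (at z)" for z
    using assms(3,4) by (cases "f z") (auto simp: pole lim finite_part_def)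
  moreover have "f z = None \<longleftrightarrow> is_pole (finite_part f) z" for z
  proof
    \<comment> \<open>At a pole of \<open>g\<close> the value of \<open>f\<close> cannot be finite,
      since \<open>g\<close> would tend both to that value and to infinity.\<close>
    assume "is_pole (finite_part f) z"
    then have "filterlim g at_infinity (at z)"
      by (simp only: pole is_pole_def[of g])
    then show "f z = None"
      using assms(4)[of z] not_tendsto_and_filterlim_at_infinity[of "at z" g]
      by (cases "f z") auto
  qed (simp add: pole assms(3))
  ultimately show ?thesis
    by (simp add: meromorphic_cp1_def nicely_meromorphic_on_def)
qed

text \<open>Punctured neighbourhoods determine a meromorphic map: they decide where its poles are,
  and at any other point its value is a limit. Identities known only off isolated points thereby
  become equalities of maps.\<close>

lemma meromorphic_cp1_eqI:
  assumes f: "meromorphic_cp1 f" and g: "meromorphic_cp1 g"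
    and eq: "\<And>z. eventually (\<lambda>x. finite_part f x = finite_part g x) (at z)"
  shows "f = g"
proof
  fix z
  have pole: "is_pole (finite_part f) z \<longleftrightarrow> is_pole (finite_part g) z"
    using eq by (intro is_pole_cong) auto
  show "f z = g z"
  proof (cases "is_pole (finite_part f) z")
    case True
    then have "f z = None" "g z = None"
      using f g pole by (auto simp: meromorphic_cp1_def)
    then show ?thesis
      by simp
  next
    case False
    then obtain u v where uv: "f z = Some u" "g z = Some v"
      using f g pole by (fastforce simp: meromorphic_cp1_def)
    have "(finite_part f \<longlongrightarrow> u) (at z)" "(finite_part g \<longlongrightarrow> v) (at z)"
      using f g pole False uv by (auto simp: meromorphic_cp1_def nicely_meromorphic_on_def finite_part_def)
    moreover have "(finite_part f \<longlongrightarrow> v) (at z) \<longleftrightarrow> (finite_part g \<longlongrightarrow> v) (at z)"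
      using eq by (rule tendsto_cong)
    ultimately show ?thesis
      using uv LIM_unique by metis
  qed
qed

section \<open>Invariance under a generated group\<close>

lemma invariant_under_generate_BijGroup:
  assumes "H \<subseteq> Bij UNIV"
  shows "invariant_under (generate (BijGroup UNIV) H) f \<longleftrightarrow> (\<forall>h\<in>H. \<forall>z. f (h z) = f z)"
proof
  assume "invariant_under (generate (BijGroup UNIV) H) f"
  then show "\<forall>h\<in>H. \<forall>z. f (h z) = f z"
    by (auto simp: invariant_under_def intro: generate.incl)
next
  assume H: "\<forall>h\<in>H. \<forall>z. f (h z) = f z"
  \<comment> \<open>Membership in \<open>Bij UNIV\<close> is carried through the induction because
    the multiplication and inverse of \<open>BijGroup\<close> are composition and inverse map only
    on bijections.\<close>
  have "g \<in> Bij UNIV \<and> (\<forall>z. f (g z) = f z)" if "g \<in> generate (BijGroup UNIV) H" for g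
    using that
  proof induction
    case one
    then show ?case
      using id_Bij[of UNIV] by (simp add: BijGroup_def restrict_UNIV)
  next
    case (incl h)
    then show ?case
      using H assms by auto
  next
    case (inv h)
    then have h: "h \<in> Bij UNIV"
      using assms by auto
    then have "f (inv_into UNIV h z) = f z" for z
      using H inv f_inv_into_f[of z h UNIV] by (metis Bij_def Int_iff bij_betw_imp_surj_on mem_Collect_eq UNIV_I)
    then show ?case
      using restrict_inv_into_Bij[OF h] by (simp add: inv_BijGroup[OF h] restrict_UNIV)
  next
    case (eng g h)
    then show ?case
      using compose_Bij[of g UNIV h] by (simp add: BijGroup_def compose_def restrict_UNIV)
  qed
  then show "invariant_under (generate (BijGroup UNIV) H) f"
    by (simp add: invariant_under_def)
qed

section \<open>The square lattice and its Weierstrass function\<close>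

locale square_lattice =
  fixes w :: complex
  assumes w: "w \<noteq> 0"
begin

section \<open>The lattice: symmetries, discreteness, reduction to a bounded region\<close>

definition L where "L = lattice_of w (\<i> * w)"

lemma L_eq: "L = range (\<lambda>(m, n). (of_int m + \<i> * of_int n) * w)"
  by (auto simp: L_def lattice_of_def image_iff algebra_simps)

lemma L_iff: "z \<in> L \<longleftrightarrow> (\<exists>m n. z = (of_int m + \<i> * of_int n) * w)"
  by (auto simp: L_eq)

lemma zero_in_L: "0 \<in> L"
  unfolding L_iff by (rule exI[of _ 0], rule exI[of _ 0]) simp

lemma minus_in_L: "z \<in> L \<Longrightarrow> - z \<in> L"
  unfolding L_iff by (metis (no_types, opaque_lifting) add_uminus_conv_diff minus_add_distrib mult_minus_left mult_minus_right of_int_minus)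

lemma add_in_L: "x \<in> L \<Longrightarrow> y \<in> L \<Longrightarrow> x + y \<in> L"
proof -
  assume "x \<in> L" "y \<in> L"
  then obtain a b c d where "x = (of_int a + \<i> * of_int b) * w" "y = (of_int c + \<i> * of_int d) * w"
    unfolding L_iff by blast
  then have "x + y = (of_int (a + c) + \<i> * of_int (b + d)) * w"
    by (simp add: algebra_simps)
  then show ?thesis
    unfolding L_iff by blast
qed

lemma diff_in_L: "x \<in> L \<Longrightarrow> y \<in> L \<Longrightarrow> x - y \<in> L"
  using add_in_L[of x "-y"] minus_in_L by simp

lemma ii_in_L: "z \<in> L \<Longrightarrow> \<i> * z \<in> L"
proof -
  assume "z \<in> L"
  then obtain a b where "z = (of_int a + \<i> * of_int b) * w"
    unfolding L_iff by blast
  then have "\<i> * z = (of_int (-b) + \<i> * of_int a) * w"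
    by (simp add: algebra_simps)
  then show ?thesis
    unfolding L_iff by blast
qed

lemma bij_L_add: "\<omega> \<in> L \<Longrightarrow> bij_betw (\<lambda>z. z + \<omega>) L L"
  by (rule bij_betw_byWitness[where f' = "\<lambda>z. z - \<omega>"]) (auto intro: add_in_L diff_in_L)

lemma bij_L_ii: "bij_betw (\<lambda>z. \<i> * z) L L"
proof (rule bij_betw_byWitness[where f' = "\<lambda>z. - (\<i> * z)"])
  show "(\<lambda>z. - (\<i> * z)) ` L \<subseteq> L"
    using ii_in_L minus_in_L by auto
qed (auto intro: ii_in_L simp flip: mult.assoc)

text \<open>Both integer coordinates of a lattice point are bounded by its modulus divided by
  \<open>cmod w\<close>.\<close>

lemma finite_L_ball: "finite (L \<inter> cball 0 r)"
proof -
  define N where "N = \<lceil>r / cmod w\<rceil>"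
  have "L \<inter> cball 0 r \<subseteq> (\<lambda>(m, n). (of_int m + \<i> * of_int n) * w) ` ({-N..N} \<times> {-N..N})"
  proof
    fix z assume z: "z \<in> L \<inter> cball 0 r"
    then obtain m n where mn: "z = (of_int m + \<i> * of_int n) * w"
      by (auto simp: L_iff)
    have "cmod (of_int m + \<i> * of_int n) * cmod w \<le> r"
      using z by (simp add: mn norm_mult)
    then have "cmod (of_int m + \<i> * of_int n) \<le> r / cmod w"
      using w by (simp add: pos_le_divide_eq)
    then have "\<bar>of_int m\<bar> \<le> r / cmod w" "\<bar>of_int n\<bar> \<le> r / cmod w"
      using abs_Re_le_cmod[of "of_int m + \<i> * of_int n"] abs_Im_le_cmod[of "of_int m + \<i> * of_int n"]
      by auto
    then have "\<bar>m\<bar> \<le> N" "\<bar>n\<bar> \<le> N"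
      unfolding N_def by linarith+
    then show "z \<in> (\<lambda>(m, n). (of_int m + \<i> * of_int n) * w) ` ({-N..N} \<times> {-N..N})"
      by (auto simp: mn intro!: rev_image_eqI[of "(m, n)"])
  qed
  then show ?thesis
    by (rule finite_subset) auto
qed

lemma not_islimpt_L: "\<not> z islimpt L"
proof
  assume "z islimpt L"
  then have "z islimpt L \<inter> ball z 1"
    by (rule islimpt_Int_eventually) (rule eventually_at_in_open', auto)
  moreover have "L \<inter> ball z 1 \<subseteq> L \<inter> cball 0 (norm z + 1)"
  proof
    fix x assume "x \<in> L \<inter> ball z 1"
    then show "x \<in> L \<inter> cball 0 (norm z + 1)"
      using norm_triangle_ineq2[of x z] by (auto simp: dist_norm norm_minus_commute)
  qed
  ultimately show False
    using finite_L_ball finite_subset islimpt_finite by blast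
qed

lemma eventually_notin_L: "eventually (\<lambda>x. x \<notin> L) (at z)"
  using not_islimpt_L[of z] by (simp add: islimpt_iff_eventually)

lemma summable_L_cube: "(\<lambda>\<omega>. 1 / norm \<omega> ^ 3) summable_on L"
proof -
  have "m = m' \<and> n = n'" if "(of_int m + \<i> * of_int n) * w = (of_int m' + \<i> * of_int n') * w"
    for m n m' n' :: int
    using w that unfolding mult_cancel_right by (auto simp: complex_eq_iff)
  then have "inj (\<lambda>(m :: int, n :: int). (of_int m + \<i> * of_int n) * w)"
    by (auto simp: inj_def)
  moreover have "(\<lambda>(m, n). 1 / norm ((of_int m + \<i> * of_int n) * w) ^ 3) summable_on (UNIV :: (int \<times> int) set)"
    using summable_on_cmult_left[OF summable_on_gauss_int_cube, of "1 / norm w ^ 3"]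
    by (simp add: norm_mult power_mult_distrib case_prod_unfold)
  ultimately show ?thesis
    unfolding L_eq by (subst summable_on_reindex) (auto simp: o_def case_prod_unfold)
qed

text \<open>Rounding down both coordinates of \<open>z / w\<close> leaves real and imaginary parts
  of size at most 1, whence the factor 2. The ball \<open>cball 0 (2 * norm w)\<close> thus serves
  as a compact substitute for a fundamental square.\<close>

lemma L_reduce:
  obtains \<omega> where "\<omega> \<in> L" "norm (z - \<omega>) \<le> 2 * norm w"
proof -
  define q where "q = z / w"
  define \<omega> where "\<omega> = (of_int \<lfloor>Re q\<rfloor> + \<i> * of_int \<lfloor>Im q\<rfloor>) * w"
  have "norm (q - (of_int \<lfloor>Re q\<rfloor> + \<i> * of_int \<lfloor>Im q\<rfloor>)) \<le> 1 + 1"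
    by (rule order_trans[OF cmod_le]) (auto intro!: add_mono simp: abs_le_iff; linarith)
  moreover have "z - \<omega> = (q - (of_int \<lfloor>Re q\<rfloor> + \<i> * of_int \<lfloor>Im q\<rfloor>)) * w"
    using w by (simp add: \<omega>_def q_def field_simps)
  ultimately have "norm (z - \<omega>) \<le> 2 * norm w"
    by (simp add: norm_mult mult_right_mono)
  moreover have "\<omega> \<in> L"
    unfolding L_iff \<omega>_def by blast
  ultimately show ?thesis
    using that by blast
qed

section \<open>Convergence and analyticity of the Weierstrass series\<close>

definition term_p :: "complex \<Rightarrow> complex \<Rightarrow> complex" where
  "term_p z \<omega> = 1 / (z - \<omega>) ^ 2 - 1 / \<omega> ^ 2"

text \<open>The part of the Weierstrass function that stays analytic at the origin.\<close>

definition regular_part :: "complex \<Rightarrow> complex" where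
  "regular_part z = (\<Sum>\<^sub>\<infinity>\<omega>\<in>L - {0}. term_p z \<omega>)"

text \<open>Finite-valued counterpart of \<open>weierstrass_p\<close>. Its values at lattice points
  are artefacts of division by zero; \<open>weierstrass_p_eq\<close> puts \<open>None\<close> in
  their place.\<close>

definition wp :: "complex \<Rightarrow> complex" where
  "wp z = 1 / z ^ 2 + regular_part z"

text \<open>Subtracting \<open>1 / \<omega> ^ 2\<close> gains one order of decay: over a common
  denominator the numerator is \<open>z * (2 * \<omega> - z)\<close>, of modulus at most
  \<open>R * 5/2 * norm \<omega>\<close>, while
  \<open>norm (z - \<omega>) \<ge> norm \<omega> / 2\<close> bounds the denominator below by
  \<open>norm \<omega> ^ 4 / 4\<close>. The constant 10 is 5/2 times 4.\<close>

lemma term_p_bound: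
  assumes "norm z \<le> R" "2 * R \<le> norm \<omega>" "R > 0"
  shows "norm (term_p z \<omega>) \<le> 10 * R * (1 / norm \<omega> ^ 3)"
proof -
  have \<omega>: "norm \<omega> > 0"
    using assms by linarith
  have half: "norm \<omega> / 2 \<le> norm (z - \<omega>)"
    using norm_triangle_ineq2[of \<omega> z] assms by (simp add: norm_minus_commute)
  then have z\<omega>: "norm (z - \<omega>) > 0"
    using \<omega> by linarith
  have "norm (2 * \<omega> - z) \<le> 5 / 2 * norm \<omega>"
    using norm_triangle_ineq4[of "2 * \<omega>" z] assms by (simp add: norm_mult)
  then have num: "norm z * norm (2 * \<omega> - z) \<le> R * (5 / 2 * norm \<omega>)"
    using assms by (intro mult_mono) auto
  have "(norm \<omega> / 2)\<^sup>2 \<le> (norm (z - \<omega>))\<^sup>2"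
    using half by (intro power_mono) auto
  then have den: "(norm \<omega>)\<^sup>2 / 4 * (norm \<omega>)\<^sup>2 \<le> (norm (z - \<omega>))\<^sup>2 * (norm \<omega>)\<^sup>2"
    by (intro mult_right_mono) (auto simp: power_divide)
  have "term_p z \<omega> = z * (2 * \<omega> - z) / ((z - \<omega>)\<^sup>2 * \<omega>\<^sup>2)"
    using \<omega> z\<omega> by (simp add: term_p_def divide_simps) (simp add: algebra_simps power2_eq_square)
  then have "norm (term_p z \<omega>) = norm z * norm (2 * \<omega> - z) / ((norm (z - \<omega>))\<^sup>2 * (norm \<omega>)\<^sup>2)"
    by (simp add: norm_mult norm_divide norm_power)
  also have "\<dots> \<le> R * (5 / 2 * norm \<omega>) / ((norm \<omega>)\<^sup>2 / 4 * (norm \<omega>)\<^sup>2)"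
    using num den \<omega> assms by (intro frac_le) auto
  also have "\<dots> = 10 * R * (1 / norm \<omega> ^ 3)"
    using \<omega> by (simp add: field_simps power2_eq_square power3_eq_cube)
  finally show ?thesis .
qed

lemma summable_tail_bound: "(\<lambda>\<omega>. 10 * R * (1 / norm \<omega> ^ 3)) summable_on L - ball 0 (2 * R)"
  by (intro summable_on_cmult_right summable_on_subset_banach[OF summable_L_cube]) auto

lemma finite_L_head: "finite (L \<inter> ball 0 r)"
  by (rule finite_subset[OF _ finite_L_ball[of r]]) auto

lemma summable_term_p:
  assumes "A \<subseteq> L"
  shows "term_p z summable_on A"
proof -
  define R where "R = norm z + 1"
  have "(\<lambda>\<omega>. norm (term_p z \<omega>)) summable_on L - ball 0 (2 * R)"
    by (rule Infinite_Sum.abs_summable_on_comparison_test'[OF summable_tail_bound])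
      (rule term_p_bound, auto simp: R_def intro: add_nonneg_pos)
  then have "term_p z summable_on L - ball 0 (2 * R)"
    by (rule abs_summable_summable)
  then have "term_p z summable_on (L \<inter> ball 0 (2 * R)) \<union> (L - ball 0 (2 * R))"
    by (rule summable_on_Un_disjoint[OF summable_on_finite[OF finite_L_head]]) auto
  then have "term_p z summable_on L"
    by (simp add: Int_Diff_Un)
  then show ?thesis
    using assms by (rule summable_on_subset_banach)
qed

text \<open>Weierstrass M-test with the majorant of \<open>summable_tail_bound\<close>. The cut-off
  at \<open>2 * R\<close> keeps the poles of all remaining terms outside \<open>cball 0 R\<close>,
  so the finite partial sums are holomorphic and converge uniformly.\<close>

lemma holomorphic_tail:
  assumes "R > 0"
  shows "(\<lambda>z. \<Sum>\<^sub>\<infinity>\<omega>\<in>L - ball 0 (2 * R). term_p z \<omega>) holomorphic_on ball 0 R"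
proof -
  have lim: "uniform_limit (cball 0 R) (\<lambda>X z. \<Sum>\<omega>\<in>X. term_p z \<omega>)
          (\<lambda>z. \<Sum>\<^sub>\<infinity>\<omega>\<in>L - ball 0 (2 * R). term_p z \<omega>) (finite_subsets_at_top (L - ball 0 (2 * R)))"
    by (rule Weierstrass_m_test_general[OF _ summable_tail_bound])
      (rule term_p_bound, use assms in auto)
  have hol: "(\<lambda>z. \<Sum>\<omega>\<in>X. term_p z \<omega>) holomorphic_on cball 0 R" if "X \<subseteq> L - ball 0 (2 * R)" for X
    unfolding term_p_def using that assms by (intro holomorphic_intros) (auto simp: subset_iff)
  have "eventually (\<lambda>X. continuous_on (cball 0 R) (\<lambda>z. \<Sum>\<omega>\<in>X. term_p z \<omega>) \<and>
           (\<lambda>z. \<Sum>\<omega>\<in>X. term_p z \<omega>) holomorphic_on ball 0 R) (finite_subsets_at_top (L - ball 0 (2 * R)))"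
    by (rule eventually_finite_subsets_at_top_weakI)
      (auto intro!: holomorphic_on_imp_continuous_on hol holomorphic_on_subset[OF hol])
  from holomorphic_uniform_limit[OF this lim] show ?thesis
    by auto
qed

lemma regular_part_analytic:
  assumes "z \<notin> L - {0}"
  shows "regular_part analytic_on {z}"
proof -
  \<comment> \<open>The summand 1 makes \<open>R\<close> positive and puts \<open>z\<close> inside
    the open ball of \<open>holomorphic_tail\<close>.\<close>
  define R where "R = norm z + 1"
  have R: "R > 0"
    by (smt (verit) R_def norm_ge_zero)
  define H where "H = (L - {0}) \<inter> ball 0 (2 * R)"
  have fin: "finite H"
    unfolding H_def by (rule finite_subset[OF _ finite_L_head[of "2 * R"]]) auto
  have split: "regular_part x = (\<Sum>\<omega>\<in>H. term_p x \<omega>) + (\<Sum>\<^sub>\<infinity>\<omega>\<in>L - ball 0 (2 * R). term_p x \<omega>)" for x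
  proof -
    have "L - {0} = H \<union> (L - ball 0 (2 * R))"
      using R by (auto simp: H_def)
    then have "regular_part x = infsum (term_p x) (H \<union> (L - ball 0 (2 * R)))"
      by (simp add: regular_part_def)
    also have "\<dots> = infsum (term_p x) H + infsum (term_p x) (L - ball 0 (2 * R))"
      by (intro infsum_Un_disjoint summable_term_p) (auto simp: H_def)
    finally show ?thesis
      using fin by simp
  qed
  have "(\<lambda>x. \<Sum>\<^sub>\<infinity>\<omega>\<in>L - ball 0 (2 * R). term_p x \<omega>) analytic_on {z}"
    by (rule holomorphic_on_imp_analytic_at[OF holomorphic_tail[OF R]]) (auto simp: R_def)
  moreover have "(\<lambda>x. term_p x \<omega>) analytic_on {z}" if "\<omega> \<in> H" for \<omega>
    unfolding term_p_def using that assms by (intro analytic_intros) (auto simp: H_def)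
  ultimately show ?thesis
    unfolding split[abs_def] by (intro analytic_intros) auto
qed

section \<open>Analyticity and symmetries of \<open>wp\<close>\<close>

lemma wp_analytic: "wp analytic_on {z}" if "z \<notin> L"
proof -
  have "z \<noteq> 0"
    using that zero_in_L by auto
  then show ?thesis
    unfolding wp_def[abs_def] using that by (intro analytic_intros regular_part_analytic) auto
qed

text \<open>Division by zero yields zero, so the term of \<open>\<omega> = 0\<close> is \<open>1 / z\<^sup>2\<close> and reindexing the
  sum over the whole lattice is unproblematic.\<close>

lemma wp_has_sum: "(term_p z has_sum wp z) L"
proof -
  have "(term_p z has_sum (term_p z 0 + regular_part z)) (insert 0 (L - {0}))"
    unfolding regular_part_def by (intro has_sum_insert has_sum_infsum summable_term_p) auto
  then show ?thesis
    using zero_in_L by (simp add: insert_absorb term_p_def wp_def)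
qed

text \<open>Reindexing shows that \<open>wp (z + a) - wp z\<close> is a constant independent of \<open>z\<close>; the
  substitution \<open>\<omega> \<mapsto> - \<omega> - a\<close> shows that this constant is its own negative.\<close>

lemma wp_periodic:
  assumes a: "a \<in> L"
  shows "wp (z + a) = wp z"
proof -
  have "((\<lambda>\<omega>. term_p (z + a) (\<omega> + a)) has_sum wp (z + a)) L"
    using wp_has_sum[of "z + a"] by (subst has_sum_reindex_bij_betw[OF bij_L_add[OF a], of "term_p (z + a)"])
  then have diff: "((\<lambda>\<omega>. term_p (z + a) (\<omega> + a) - term_p z \<omega>) has_sum wp (z + a) - wp z) L"
    by (rule has_sum_minus[OF _ wp_has_sum])
  then have 1: "((\<lambda>\<omega>. 1 / \<omega>\<^sup>2 - 1 / (\<omega> + a)\<^sup>2) has_sum wp (z + a) - wp z) L"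
    by (simp add: term_p_def)
  have "bij_betw (\<lambda>\<omega>. - \<omega> - a) L L"
    by (rule bij_betw_byWitness[where f' = "\<lambda>\<omega>. - \<omega> - a"]) (use a in \<open>auto intro!: diff_in_L minus_in_L\<close>)
  then have "((\<lambda>\<omega>. 1 / (- \<omega> - a)\<^sup>2 - 1 / (- \<omega> - a + a)\<^sup>2) has_sum wp (z + a) - wp z) L"
    using 1 by (subst has_sum_reindex_bij_betw[of _ L L "\<lambda>\<omega>. 1 / \<omega>\<^sup>2 - 1 / (\<omega> + a)\<^sup>2"])
  moreover have "(- \<omega> - a)\<^sup>2 = (\<omega> + a)\<^sup>2" for \<omega>
    by (simp add: power2_eq_square algebra_simps)
  ultimately have "((\<lambda>\<omega>. 1 / (\<omega> + a)\<^sup>2 - 1 / \<omega>\<^sup>2) has_sum wp (z + a) - wp z) L"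
    by simp
  moreover have "((\<lambda>\<omega>. 1 / (\<omega> + a)\<^sup>2 - 1 / \<omega>\<^sup>2) has_sum - (wp (z + a) - wp z)) L"
    using has_sum_uminusI[OF 1] by simp
  ultimately have "wp (z + a) - wp z = - (wp (z + a) - wp z)"
    by (rule has_sum_unique)
  then show ?thesis
    by simp
qed

text \<open>Multiplication by \<open>\<i>\<close> permutes the lattice, and every squared difference
  picks up the factor \<open>\<i> ^ 2 = -1\<close>, so after reindexing each term changes
  sign.\<close>

lemma wp_ii: "wp (\<i> * z) = - wp z"
proof -
  have "((\<lambda>\<omega>. term_p (\<i> * z) (\<i> * \<omega>)) has_sum wp (\<i> * z)) L"
    using wp_has_sum[of "\<i> * z"] by (subst has_sum_reindex_bij_betw[OF bij_L_ii, of "term_p (\<i> * z)"])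
  moreover have "term_p (\<i> * z) (\<i> * \<omega>) = - term_p z \<omega>" for \<omega>
  proof -
    have "(\<i> * z - \<i> * \<omega>)\<^sup>2 = - ((z - \<omega>)\<^sup>2)"
      by (simp add: power_mult_distrib flip: right_diff_distrib)
    then show ?thesis
      by (simp add: term_p_def power_mult_distrib)
  qed
  ultimately have "((\<lambda>\<omega>. - term_p z \<omega>) has_sum wp (\<i> * z)) L"
    by simp
  then show ?thesis
    using has_sum_unique has_sum_uminusI[OF wp_has_sum[of z]] by metis
qed

lemma weierstrass_p_eq: "weierstrass_p L z = (if z \<in> L then None else Some (wp z))"
  by (simp add: weierstrass_p_def wp_def regular_part_def term_p_def)

section \<open>The squared function \<open>U\<close>: symmetries, poles and values\<close>

definition U :: "complex \<Rightarrow> complex" where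
  "U z = (wp z)\<^sup>2"

lemma U_periodic: "a \<in> L \<Longrightarrow> U (z + a) = U z"
  by (simp add: U_def wp_periodic)

lemma U_ii: "U (\<i> * z) = U z"
  by (simp add: U_def wp_ii)

lemma U_analytic: "U analytic_on {z}" if "z \<notin> L"
  unfolding U_def[abs_def] using that by (intro analytic_intros wp_analytic)

text \<open>Multiplied by \<open>z ^ 2\<close>, \<open>wp z\<close> becomes
  \<open>1 + z ^ 2 * regular_part z\<close>, and \<open>regular_part\<close> is continuous at the
  origin. Because the limit is 1, \<open>l * U z ^ k\<close> has leading coefficient
  \<open>l\<close>, as needed for cancellation in \<open>polynomial_in_U\<close>.\<close>

lemma U_leading: "((\<lambda>z. z ^ 4 * U z) \<longlongrightarrow> 1) (at 0)"
proof -
  have "regular_part \<midarrow>0\<rightarrow> regular_part 0"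
    using regular_part_analytic[of 0] by (intro isContD analytic_at_imp_isCont) auto
  then have "((\<lambda>z. (1 + z\<^sup>2 * regular_part z)\<^sup>2) \<longlongrightarrow> (1 + 0\<^sup>2 * regular_part 0)\<^sup>2) (at 0)"
    by (intro tendsto_intros)
  moreover have "eventually (\<lambda>z. z ^ 4 * U z = (1 + z\<^sup>2 * regular_part z)\<^sup>2) (at 0)"
    using eventually_neq_at_within[of 0 0 UNIV]
  proof eventually_elim
    case (elim z)
    have "z ^ 4 * U z = (z\<^sup>2 * wp z)\<^sup>2"
      by (simp add: U_def power_mult_distrib flip: power_mult)
    also have "z\<^sup>2 * wp z = 1 + z\<^sup>2 * regular_part z"
      using elim by (simp add: wp_def algebra_simps)
    finally show ?case .
  qed
  ultimately show ?thesis
    by (simp add: tendsto_cong)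
qed

lemma meromorphic_at_translate:
  assumes f: "\<And>x a. a \<in> L \<Longrightarrow> f (x + a) = f x" and a: "a \<in> L" and "f meromorphic_on {0}"
  shows "f meromorphic_on {a}"
proof -
  have "(\<lambda>x. f (x - a)) meromorphic_on {a}"
    by (rule meromorphic_on_compose[OF assms(3)]) (auto intro!: analytic_intros)
  moreover have "f (x - a) = f x" for x
    using f[of "-a" x] minus_in_L[OF a] by simp
  ultimately show ?thesis
    by simp
qed

lemma U_meromorphic: "U meromorphic_on A"
proof -
  have "U meromorphic_on {z}" for z
  proof (cases "z \<in> L")
    case True
    have "regular_part meromorphic_on {0}"
      by (rule analytic_on_imp_meromorphic_on[OF regular_part_analytic]) auto
    then have "U meromorphic_on {0}"
      unfolding U_def[abs_def] wp_def by (intro meromorphic_intros)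
    then show ?thesis
      using U_periodic True by (rule meromorphic_at_translate[rotated 2])
  next
    case False
    then show ?thesis
      by (intro analytic_on_imp_meromorphic_on U_analytic)
  qed
  then show ?thesis
    by (subst meromorphic_on_meromorphic_at) auto
qed

text \<open>The target filter is left arbitrary so that finite limits and poles are transported
  alike.\<close>

lemma filterlim_translate:
  assumes f: "\<And>x a. a \<in> L \<Longrightarrow> f (x + a) = f x" and a: "a \<in> L"
  shows "filterlim f F (at (z + a)) \<longleftrightarrow> filterlim f F (at z)"
proof -
  have "at (z + a) = filtermap (\<lambda>x. x + a) (at z)"
    by (simp add: filtermap_at_shift[of "-a" z, simplified])
  then show ?thesis
    using f[OF a] by (simp add: filterlim_filtermap)
qed

lemma U_pole: "filterlim U at_infinity (at a)" if "a \<in> L"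
proof -
  have "filterlim (\<lambda>z. (z ^ 4 * U z) / z ^ 4) at_infinity (at 0)"
    using U_leading by (rule filterlim_divide_at_infinity)
      (auto intro!: filterlim_atI tendsto_eq_intros eventually_neq_at_within simp: eventually_at_filter)
  moreover have "eventually (\<lambda>z. (z ^ 4 * U z) / z ^ 4 = U z) (at 0)"
    using eventually_neq_at_within[of 0 0 UNIV] by eventually_elim auto
  ultimately have "filterlim U at_infinity (at 0)"
    by (simp add: filterlim_cong)
  then show ?thesis
    using filterlim_translate[of U a at_infinity 0] U_periodic that by simp
qed

text \<open>A meromorphic function either equals \<open>c\<close> or avoids \<open>c\<close> off a
  sparse set; the pole at the origin rules out the first alternative.\<close>

lemma eventually_U_neq: "eventually (\<lambda>z. U z \<noteq> c) (at z0)"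
proof -
  have "eventually (\<lambda>z. U z = c) (cosparse UNIV) \<or> eventually (\<lambda>z. U z \<noteq> c) (cosparse UNIV)"
    by (rule meromorphic_imp_constant_or_avoid[OF U_meromorphic]) auto
  moreover have False if "eventually (\<lambda>z. U z = c) (cosparse UNIV)"
  proof -
    have "eventually (\<lambda>z. U z = c) (at 0)"
      using that by (rule eventually_cosparse_imp_eventually_at) auto
    then have "filterlim (\<lambda>_. c) at_infinity (at (0::complex))"
      using U_pole[OF zero_in_L] by (simp add: filterlim_cong)
    then show False
      using not_tendsto_and_filterlim_at_infinity[of "at 0" "\<lambda>_::complex. c" c] by simp
  qed
  ultimately show ?thesis
    using eventually_cosparse_imp_eventually_at by blast
qed

lemma eventually_poly_U_neq: "eventually (\<lambda>z. poly q (U z) \<noteq> 0) (at z0)" if "q \<noteq> 0"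
proof -
  have "eventually (\<lambda>z. \<forall>c\<in>{c. poly q c = 0}. U z \<noteq> c) (at z0)"
    using eventually_U_neq poly_roots_finite[OF that] by (intro eventually_ball_finite) auto
  then show ?thesis
    by eventually_elim auto
qed

section \<open>Functions invariant under p4\<close>

lemma limit_translate:
  assumes "\<And>x a. a \<in> L \<Longrightarrow> f (x + a) = f x" and "a \<in> L" and "(f \<longlongrightarrow> l) (at z)"
  shows "(f \<longlongrightarrow> l) (at (z + a))"
  using filterlim_translate[of f a "nhds l" z] assms by blast

text \<open>With its singularities removed the function is entire, and periodicity confines its
  range to the image of a compact ball, so Liouville applies. The conclusion concerns punctured
  neighbourhoods because \<open>f\<close> itself may deviate at isolated points.\<close>

lemma periodic_holomorphic_constant:
  assumes mero: "f meromorphic_on UNIV"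
    and per: "\<And>x a. a \<in> L \<Longrightarrow> f (x + a) = f x"
    and lim: "\<And>z. \<exists>l. (f \<longlongrightarrow> l) (at z)"
  obtains c where "\<And>z. eventually (\<lambda>x. f x = c) (at z)"
proof -
  define h where "h = remove_sings f"
  have iso: "isolated_singularity_at f z" for z
    using mero by (simp add: meromorphic_on_altdef)
  have "h analytic_on {z}" for z
    using lim[of z] remove_sings_analytic_at[OF iso] unfolding h_def by blast
  then have hol: "h holomorphic_on UNIV"
    by (meson analytic_imp_holomorphic analytic_on_analytic_at)
  have h_per: "h (z + a) = h z" if "a \<in> L" for z a
  proof -
    obtain l where l: "(f \<longlongrightarrow> l) (at z)"
      using lim by blast
    then have "(f \<longlongrightarrow> l) (at (z + a))"
      using per that by (rule limit_translate[rotated 2])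
    then show ?thesis
      using l by (simp add: h_def remove_sings_eqI)
  qed
  have "range h \<subseteq> h ` cball 0 (2 * norm w)"
  proof (rule image_subsetI)
    fix z
    obtain \<omega> where \<omega>: "\<omega> \<in> L" "norm (z - \<omega>) \<le> 2 * norm w"
      by (rule L_reduce)
    then show "h z \<in> h ` cball 0 (2 * norm w)"
      using h_per[OF \<omega>(1), of "z - \<omega>"] by (intro image_eqI[of _ _ "z - \<omega>"]) auto
  qed
  moreover have "compact (h ` cball 0 (2 * norm w))"
    using hol by (intro compact_continuous_image holomorphic_on_imp_continuous_on)
      (auto elim: holomorphic_on_subset)
  ultimately have "bounded (range h)"
    using bounded_subset compact_imp_bounded by blast
  then obtain c where "h z = c" for z
    using Liouville_theorem[OF hol] by (auto simp: constant_on_def)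
  then have "eventually (\<lambda>x. f x = c) (at z)" for z
    using eventually_remove_sings_eq_at[OF iso, of z] by (simp add: h_def eq_commute)
  then show ?thesis
    using that by blast
qed

text \<open>Induction on a bound \<open>n\<close> for the pole order at the origin; \<open>f\<close>
  is generalised because each step passes to a difference \<open>g\<close>.\<close>

lemma polynomial_in_U:
  assumes "f meromorphic_on UNIV"
    and "\<And>x a. a \<in> L \<Longrightarrow> f (x + a) = f x"
    and "\<And>x. f (\<i> * x) = f x"
    and "\<And>z. z \<notin> L \<Longrightarrow> \<exists>l. (f \<longlongrightarrow> l) (at z)"
    and "((\<lambda>z. z ^ n * f z) \<longlongrightarrow> l) (at 0)"
  shows "\<exists>p. \<forall>z. eventually (\<lambda>x. f x = poly p (U x)) (at z)"
  using assms
proof (induction n arbitrary: f l)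
  case 0
  \<comment> \<open>The finite limit at the origin spreads to all lattice points by periodicity, so
    every singularity is removable.\<close>
  then have f0: "(f \<longlongrightarrow> l) (at 0)"
    by simp
  have "\<exists>l. (f \<longlongrightarrow> l) (at z)" for z
  proof (cases "z \<in> L")
    case True
    then show ?thesis
      using limit_translate[OF "0.prems"(2) True f0] by auto
  qed (use 0 in auto)
  then obtain c where "\<And>z. eventually (\<lambda>x. f x = c) (at z)"
    using periodic_holomorphic_constant "0.prems"(1,2) by blast
  then show ?case
    by (intro exI[of _ "[:c:]"]) simp
next
  case (Suc n)
  \<comment> \<open>For nonzero \<open>l\<close> the division turns out to be exact; for
    \<open>l = 0\<close> the subtracted term vanishes whatever \<open>k\<close> is.\<close>
  define k where "k = Suc n div 4"
  define g where "g = (\<lambda>z. f z - l * U z ^ k)"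
  have g0: "((\<lambda>z. z ^ Suc n * g z) \<longlongrightarrow> 0) (at 0)"
  proof (cases "l = 0")
    case True
    then show ?thesis
      using Suc.prems(5) by (simp add: g_def)
  next
    case False
    \<comment> \<open>Replacing \<open>z\<close> by \<open>\<i> * z\<close> multiplies the limit by
      \<open>\<i> ^ Suc n\<close>, yet invariance of \<open>f\<close> leaves it equal to
      \<open>l\<close>; uniqueness of limits then forces the factor to be 1.\<close>
    have "((\<lambda>z. (\<i> * z) ^ Suc n * f (\<i> * z)) \<longlongrightarrow> l) (at 0)"
      using filterlim_at_0_cmult[OF Suc.prems(5), of \<i>] by simp
    then have "((\<lambda>z. \<i> ^ Suc n * (z ^ Suc n * f z)) \<longlongrightarrow> l) (at 0)"
      by (simp only: Suc.prems(3) power_mult_distrib mult.assoc)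
    moreover have "((\<lambda>z. \<i> ^ Suc n * (z ^ Suc n * f z)) \<longlongrightarrow> \<i> ^ Suc n * l) (at 0)"
      by (intro tendsto_intros Suc.prems(5))
    ultimately have "\<i> ^ Suc n * l = l"
      by (metis LIM_unique)
    then have "4 dvd Suc n"
      using False by (intro ii_power_eq_1_imp_dvd) (simp del: power_Suc)
    then have n: "Suc n = 4 * k"
      by (simp add: k_def)
    have "((\<lambda>z. z ^ Suc n * f z - l * (z ^ 4 * U z) ^ k) \<longlongrightarrow> l - l * 1 ^ k) (at 0)"
      by (intro tendsto_intros Suc.prems(5) U_leading)
    moreover have "z ^ Suc n * f z - l * (z ^ 4 * U z) ^ k = z ^ Suc n * g z" for z
    proof -
      have "(z ^ 4 * U z) ^ k = z ^ Suc n * U z ^ k"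
        by (simp only: n power_mult power_mult_distrib)
      then show ?thesis
        by (simp add: g_def right_diff_distrib mult.left_commute del: power_Suc)
    qed
    ultimately show ?thesis
      by simp
  qed
  have g_mero: "g meromorphic_on UNIV"
    unfolding g_def by (intro meromorphic_intros Suc.prems(1) U_meromorphic)
  obtain l' where l': "((\<lambda>z. z ^ n * g z) \<longlongrightarrow> l') (at 0)"
    using meromorphic_vanishing_limit_divide[of g 0 n] meromorphic_on_subset[OF g_mero] g0 by auto
  have "\<exists>p. \<forall>z. eventually (\<lambda>x. g x = poly p (U x)) (at z)"
  proof (rule Suc.IH[OF g_mero _ _ _ l'])
    show "\<exists>l. (g \<longlongrightarrow> l) (at z)" if "z \<notin> L" for z
    proof -
      obtain l1 where "(f \<longlongrightarrow> l1) (at z)"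
        using Suc.prems(4)[OF \<open>z \<notin> L\<close>] by blast
      moreover have "(U \<longlongrightarrow> U z) (at z)"
        using U_analytic[OF that] by (intro isContD analytic_at_imp_isCont)
      ultimately have "(g \<longlongrightarrow> l1 - l * U z ^ k) (at z)"
        unfolding g_def by (intro tendsto_intros)
      then show ?thesis ..
    qed
  qed (simp_all add: g_def Suc.prems(2,3) U_periodic U_ii)
  then obtain p where "\<And>z. eventually (\<lambda>x. g x = poly p (U x)) (at z)"
    by blast
  then have "eventually (\<lambda>x. f x = poly (p + monom l k) (U x)) (at z)" for z
    by (rule eventually_mono[of _ "at z"]) (simp add: g_def poly_monom algebra_simps)
  then show ?case
    by blast
qed

text \<open>A power of \<open>U - U a\<close> cancels the pole at \<open>a\<close>, and extra
  factors do no harm at points treated earlier, since \<open>U\<close> is continuous off the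
  lattice.\<close>

lemma clear_poles:
  assumes mero: "f meromorphic_on UNIV" and "finite A" and "A \<inter> L = {}"
  shows "\<exists>q. q \<noteq> 0 \<and> (\<forall>a\<in>A. \<exists>l. ((\<lambda>z. f z * poly q (U z)) \<longlongrightarrow> l) (at a))"
  using assms(2,3)
proof (induction A rule: finite_induct)
  case empty
  show ?case
    by (intro exI[of _ 1]) auto
next
  case (insert a A)
  then obtain q where q: "q \<noteq> 0" "\<And>b. b \<in> A \<Longrightarrow> \<exists>l. ((\<lambda>z. f z * poly q (U z)) \<longlongrightarrow> l) (at b)"
    by auto
  have cont: "(U \<longlongrightarrow> U b) (at b)" if "b \<in> insert a A" for b
    using insert.prems that by (intro isContD analytic_at_imp_isCont U_analytic) auto
  obtain n l where l: "((\<lambda>x. (x - a) ^ n * f x) \<longlongrightarrow> l) (at a)"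
    using meromorphic_pole_order_bound[of f a] meromorphic_on_subset[OF mero] by blast
  obtain D where "(U has_field_derivative D) (at a)"
    using insert.prems U_analytic[of a] analytic_on_imp_differentiable_at field_differentiable_def by blast
  then have "((\<lambda>x. (U x - U a) / (x - a)) \<longlongrightarrow> D) (at a)"
    by (simp add: has_field_derivative_iff)
  \<comment> \<open>The \<open>n\<close> factors \<open>x - a\<close> cancel against the
    denominators of the difference quotients. The limit is finite even if \<open>D\<close> is 0, so
    the order of the zero of \<open>U - U a\<close> never enters.\<close>
  with l have "((\<lambda>x. ((x - a) ^ n * f x) * ((U x - U a) / (x - a)) ^ n * poly q (U x)) \<longlongrightarrow> l * D ^ n * poly q (U a)) (at a)"
    by (intro tendsto_intros cont) auto
  moreover have "eventually (\<lambda>x. ((x - a) ^ n * f x) * ((U x - U a) / (x - a)) ^ n * poly q (U x) =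
      f x * poly ([:- U a, 1:] ^ n * q) (U x)) (at a)"
    using eventually_neq_at_within[of a a UNIV]
    by eventually_elim (simp add: power_divide)
  ultimately have "((\<lambda>x. f x * poly ([:- U a, 1:] ^ n * q) (U x)) \<longlongrightarrow> l * D ^ n * poly q (U a)) (at a)"
    by (simp add: tendsto_cong)
  moreover have "\<exists>l. ((\<lambda>x. f x * poly ([:- U a, 1:] ^ n * q) (U x)) \<longlongrightarrow> l) (at b)" if "b \<in> A" for b
  proof -
    obtain l where "((\<lambda>z. f z * poly q (U z)) \<longlongrightarrow> l) (at b)"
      using q(2)[OF \<open>b \<in> A\<close>] by blast
    then have "((\<lambda>z. (f z * poly q (U z)) * (U z - U a) ^ n) \<longlongrightarrow> l * (U b - U a) ^ n) (at b)"
      using that by (intro tendsto_intros cont) auto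
    then show ?thesis
      by (auto simp: mult_ac)
  qed
  ultimately show ?case
    using q(1) by (intro exI[of _ "[:- U a, 1:] ^ n * q"]) auto
qed

lemma rational_in_U:
  assumes mero: "f meromorphic_on UNIV"
    and per: "\<And>x a. a \<in> L \<Longrightarrow> f (x + a) = f x"
    and ii: "\<And>x. f (\<i> * x) = f x"
  obtains p q where "q \<noteq> 0" "\<And>z. eventually (\<lambda>x. f x = poly p (U x) / poly q (U x)) (at z)"
proof -
  \<comment> \<open>Singularities of a meromorphic function are sparse, so only finitely many lie in
    the compact ball, which contains a representative of every point modulo
    \<open>L\<close>.\<close>
  define A where "A = (cball 0 (2 * norm w) \<inter> {z. \<not> f analytic_on {z}}) - L"
  have "finite (cball 0 (2 * norm w) \<inter> {z. \<not> f analytic_on {z}})"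
    by (rule sparse_in_compact_finite)
      (auto intro: sparse_in_subset[OF meromorphic_on_imp_sparse_singularities[OF mero]])
  then have "finite A" "A \<inter> L = {}"
    by (auto simp: A_def)
  then obtain q where q: "q \<noteq> 0" and lim: "\<And>a. a \<in> A \<Longrightarrow> \<exists>l. ((\<lambda>z. f z * poly q (U z)) \<longlongrightarrow> l) (at a)"
    using clear_poles[OF mero, of A] by blast
  define g where "g = (\<lambda>z. f z * poly q (U z))"
  have g_mero: "g meromorphic_on UNIV"
    unfolding g_def by (intro meromorphic_intros mero meromorphic_on_poly_compose U_meromorphic)
  have g_per: "g (x + a) = g x" if "a \<in> L" for x a
    using that by (simp add: g_def per U_periodic)
  have g_ii: "g (\<i> * x) = g x" for x
    by (simp add: g_def ii U_ii)
  have g_lim: "\<exists>l. (g \<longlongrightarrow> l) (at z)" if "z \<notin> L" for z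
  proof -
    \<comment> \<open>The point is moved into the ball, where either \<open>f\<close> is analytic or
      \<open>q\<close> was chosen to clear the singularity; periodicity carries the limit
      back.\<close>
    obtain \<omega> where \<omega>: "\<omega> \<in> L" "norm (z - \<omega>) \<le> 2 * norm w"
      by (rule L_reduce)
    have notin: "z - \<omega> \<notin> L"
      using that add_in_L[OF _ \<omega>(1), of "z - \<omega>"] by auto
    have "\<exists>l. (g \<longlongrightarrow> l) (at (z - \<omega>))"
    proof (cases "f analytic_on {z - \<omega>}")
      case True
      then have "(f \<longlongrightarrow> f (z - \<omega>)) (at (z - \<omega>))" "(U \<longlongrightarrow> U (z - \<omega>)) (at (z - \<omega>))"
        using U_analytic[OF notin] by (auto intro: isContD analytic_at_imp_isCont)
      then show ?thesis
        unfolding g_def by (auto intro!: tendsto_eq_intros)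
    next
      case False
      then show ?thesis
        unfolding g_def using notin \<omega> by (intro lim) (auto simp: A_def)
    qed
    then show ?thesis
      using limit_translate[OF g_per \<omega>(1), of _ "z - \<omega>"] by auto
  qed
  obtain n l where l: "((\<lambda>x. (x - 0) ^ n * g x) \<longlongrightarrow> l) (at 0)"
    using meromorphic_pole_order_bound[of g 0] meromorphic_on_subset[OF g_mero] by blast
  then obtain p where p: "\<And>z. eventually (\<lambda>x. g x = poly p (U x)) (at z)"
    using polynomial_in_U[OF g_mero g_per g_ii g_lim, of n l] by auto
  have "eventually (\<lambda>x. f x = poly p (U x) / poly q (U x)) (at z)" for z
    using p[of z] eventually_poly_U_neq[OF q, of z]
    by eventually_elim (simp add: g_def field_simps)
  then show ?thesis
    using q that by blast
qed

section \<open>The correspondence between invariant maps and rational functions\<close>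

lemma invariant_under_p4:
  "invariant_under (p4_group L) f \<longleftrightarrow> (\<forall>a\<in>L. \<forall>z. f (z + a) = f z) \<and> (\<forall>z. f (\<i> * z) = f z)"
proof -
  have "bij (\<lambda>z. z + a)" for a :: complex
    by (rule bij_betw_byWitness[where f' = "\<lambda>z. z - a"]) auto
  moreover have "bij (\<lambda>z. \<i> * z)"
    by (rule bij_betw_byWitness[where f' = "\<lambda>z. - (\<i> * z)"]) (auto simp flip: mult.assoc)
  ultimately have "{(\<lambda>z. z + \<omega>) | \<omega>. \<omega> \<in> L} \<union> {(\<lambda>z. \<i> * z)} \<subseteq> Bij UNIV"
    by (auto simp: Bij_def)
  then show ?thesis
    unfolding p4_group_def by (subst invariant_under_generate_BijGroup) auto
qed

definition u :: "complex \<Rightarrow> cp1" where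
  "u z = cp1_square (weierstrass_p L z)"

lemma u_eq: "u z = (if z \<in> L then None else Some (U z))"
  by (simp add: u_def cp1_square_def weierstrass_p_eq U_def)

text \<open>The generators preserve both membership in \<open>L\<close>, hence the value
  \<open>None\<close> of \<open>u\<close>, and the values of \<open>U\<close>.\<close>

lemma rat_fun_u_invariant: "invariant_under (p4_group L) (\<lambda>z. rat_fun T (u z))"
proof -
  have "z + a \<in> L \<longleftrightarrow> z \<in> L" if "a \<in> L" for z a
    using that add_in_L diff_in_L[of "z + a" a] by auto
  moreover have "\<i> * z \<in> L \<longleftrightarrow> z \<in> L" for z
    using ii_in_L[of z] minus_in_L[OF ii_in_L[of "\<i> * z"]] by (auto simp flip: mult.assoc)
  ultimately show ?thesis
    by (auto simp: invariant_under_p4 u_eq U_periodic U_ii)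
qed

text \<open>Off the lattice the map is given by \<open>p\<close> and \<open>q\<close> evaluated at
  \<open>U\<close>; at lattice points \<open>U\<close> tends to infinity, so the degrees of
  \<open>p\<close> and \<open>q\<close> decide between a pole and a finite limit, matching the
  definition of \<open>rat_fun\<close> at \<open>None\<close>.\<close>

lemma
  assumes T: "quot_of_fract T = (p, q)"
  shows rat_fun_u_finite_part:
      "eventually (\<lambda>x. finite_part (\<lambda>z. rat_fun T (u z)) x = poly p (U x) / poly q (U x)) (at z)"
    and rat_fun_u_meromorphic: "meromorphic_cp1 (\<lambda>z. rat_fun T (u z))"
proof -
  let ?f = "\<lambda>z. rat_fun T (u z)"
  let ?g = "\<lambda>z. poly p (U z) / poly q (U z)"
  have q0: "q \<noteq> 0" and cop: "coprime p q"
    using quot_of_fract_in_normalized_fracts[of T] by (auto simp: T normalized_fracts_def)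
  show ev: "eventually (\<lambda>x. finite_part ?f x = ?g x) (at z)" for z
    using eventually_notin_L[of z]
    by eventually_elim (simp add: finite_part_def u_eq rat_fun_def T)
  show "meromorphic_cp1 ?f"
  proof (rule meromorphic_cp1I[OF _ ev])
    show "?g meromorphic_on UNIV"
      by (intro meromorphic_intros meromorphic_on_poly_compose U_meromorphic)
  next
    fix z assume "?f z = None"
    then consider "z \<in> L" "degree q < degree p" | "z \<notin> L" "poly q (U z) = 0"
      by (auto simp: u_eq rat_fun_def T split: if_splits)
    then show "is_pole ?g z"
    proof cases
      case 1
      then show ?thesis
        unfolding is_pole_def
        using filterlim_compose[OF rational_filterlim_at_infinity[OF _ q0] U_pole] by blast
    next
      case 2
      have cont: "(U \<longlongrightarrow> U z) (at z)"
        using U_analytic[OF 2(1)] by (intro isContD analytic_at_imp_isCont)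
      \<comment> \<open>Lowest terms exclude a common zero, so a zero of the denominator gives a
        genuine pole.\<close>
      have "poly p (U z) \<noteq> 0"
        using coprime_poly_0[OF cop] 2(2) by auto
      moreover have "((\<lambda>x. poly p (U x)) \<longlongrightarrow> poly p (U z)) (at z)" "((\<lambda>x. poly q (U x)) \<longlongrightarrow> 0) (at z)"
        using tendsto_poly[OF cont, of p] tendsto_poly[OF cont, of q] 2(2) by simp_all
      ultimately show ?thesis
        unfolding is_pole_def using eventually_poly_U_neq[OF q0]
        by (intro filterlim_divide_at_infinity[of _ "poly p (U z)"] filterlim_atI) auto
    qed
  next
    fix z v assume v: "?f z = Some v"
    show "(?g \<longlongrightarrow> v) (at z)"
    proof (cases "z \<in> L")
      case True
      then have "degree p \<le> degree q" "v = coeff p (degree q) / lead_coeff q"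
        using v by (auto simp: u_eq rat_fun_def T split: if_splits)
      then show ?thesis
        using filterlim_compose[OF rational_tendsto_at_infinity[OF _ q0] U_pole[OF True]] by blast
    next
      case False
      then have "poly q (U z) \<noteq> 0" "v = ?g z"
        using v by (auto simp: u_eq rat_fun_def T split: if_splits)
      moreover have "(U \<longlongrightarrow> U z) (at z)"
        using U_analytic[OF False] by (intro isContD analytic_at_imp_isCont)
      ultimately show ?thesis
        by (auto intro!: tendsto_intros)
    qed
  qed
qed

lemma invariant_imp_rat_fun_u:
  assumes f: "meromorphic_cp1 f" and inv: "invariant_under (p4_group L) f"
  shows "\<exists>T. f = (\<lambda>z. rat_fun T (u z))"
proof -
  have "finite_part f meromorphic_on UNIV"
    using f by (simp add: meromorphic_cp1_def nicely_meromorphic_on_def)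
  then obtain p q where q: "q \<noteq> 0"
    and pq: "\<And>z. eventually (\<lambda>x. finite_part f x = poly p (U x) / poly q (U x)) (at z)"
    by (rule rational_in_U) (use inv in \<open>auto simp: finite_part_def invariant_under_p4\<close>)
  \<comment> \<open>The pair \<open>(p, q)\<close> may have a common factor, whereas
    \<open>rat_fun\<close> evaluates the reduced pair \<open>(p', q')\<close>; the factor
    \<open>d\<close> cancels wherever \<open>poly q (U x)\<close> is nonzero, that is, on punctured
    neighbourhoods.\<close>
  define T where "T = quot_to_fract (p, q)"
  obtain p' q' where p'q': "normalize_quot (p, q) = (p', q')"
    by force
  then have T: "quot_of_fract T = (p', q')"
    by (simp add: T_def quot_of_fract_quot_to_fract)
  obtain d where d: "p = p' * d" "q = q' * d"
    using normalize_quotE[OF q, of p] unfolding p'q' fst_conv snd_conv by blast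
  have "f = (\<lambda>z. rat_fun T (u z))"
  proof (rule meromorphic_cp1_eqI[OF f rat_fun_u_meromorphic[OF T]])
    show "eventually (\<lambda>x. finite_part f x = finite_part (\<lambda>z. rat_fun T (u z)) x) (at z)" for z
      using pq[of z] rat_fun_u_finite_part[OF T, of z] eventually_poly_U_neq[OF q, of z]
      by eventually_elim (simp add: d)
  qed
  then show ?thesis ..
qed

end

theorem mainTheorem4:
  fixes \<omega>\<^sub>1 :: complex and \<Lambda> :: "complex set"
  assumes "\<omega>\<^sub>1 \<noteq> 0"
    and "\<Lambda> = lattice_of \<omega>\<^sub>1 (\<i> * \<omega>\<^sub>1)"
  shows "{f. meromorphic_cp1 f \<and> invariant_under (p4_group \<Lambda>) f} =
         {f. \<exists>T :: complex poly fract.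
               f = (\<lambda>z. rat_fun T (cp1_square (weierstrass_p \<Lambda> z)))}"
proof -
  interpret square_lattice \<omega>\<^sub>1
    by standard (rule assms(1))
  have L: "\<Lambda> = L"
    by (simp add: assms(2) L_def)
  have "meromorphic_cp1 (\<lambda>z. rat_fun T (u z))" for T
    by (cases "quot_of_fract T") (rule rat_fun_u_meromorphic)
  then show ?thesis
    unfolding L using invariant_imp_rat_fun_u rat_fun_u_invariant by (auto simp: u_def[symmetric])
qed

end
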